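(* Let $F,F_m^S,F_n^P$ be nonnegative integers with $F\ge1$, $F_m^S\le F$, $F_n^P\le F$. Suppose that the $m$th secondary user randomly allocates $F_m^S$ subcarriers from a set of $F$ available subcarriers without replacement (i.e. a uniformly random $F_m^S$-element subset), and that $F_n^P$ of the $F$ subcarriers are being used by the $n$th primary user. Let $K_{nm}$ be the number of subcarrier collisions, i.e. the number of subcarriers allocated by the secondary user that are used by the primary user. Then $K_{nm}$ is hypergeometrically distributed: $$\Pr(K_{nm}=k_{nm})=\binom{F}{F_m^S}^{-1}\binom{F_n^P}{k_{nm}}\binom{F-F_n^P}{F_m^S-k_{nm}},$$ and the average number of collisions is $$\mathbb{E}[K_{nm}]=\frac{F_m^SF_n^P}{F}.$$
   Context: The binomial coefficient $\binom{a}{b}$ is taken to be $0$ if $b<0$ or $b>a$. *)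

theory Defs
  imports "HOL-Probability.Probability"
begin

definition subsets_of_card :: "'c set \<Rightarrow> nat \<Rightarrow> 'c set set" where
  "subsets_of_card C s = {A. A \<subseteq> C \<and> card A = s}"

definition uniform_random_subset ::
  "'w measure \<Rightarrow> 'c set \<Rightarrow> nat \<Rightarrow> ('w \<Rightarrow> 'c set) \<Rightarrow> bool" where
  "uniform_random_subset M C s S \<longleftrightarrow>
     S \<in> measurable M (uniform_count_measure (subsets_of_card C s)) \<and>
     distr M (uniform_count_measure (subsets_of_card C s)) S =
       uniform_count_measure (subsets_of_card C s)"

definition collisions :: "'c set \<Rightarrow> ('w \<Rightarrow> 'c set) \<Rightarrow> 'w \<Rightarrow> nat" where
  "collisions P S \<omega> = card (S \<omega> \<inter> P)"

(* With natural-number arguments, truncated subtraction would turn a negative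
   lower index into 0 and the coefficient into 1; hence integer arguments. *)
definition binom :: "int \<Rightarrow> int \<Rightarrow> nat" where
  "binom a b = (if b < 0 \<or> b > a then 0 else nat a choose nat b)"

end

theory Submission
  imports Defs
begin

text \<open>Because \<open>S\<close> is uniform on the \<open>FS\<close>-subsets of
  \<open>C\<close>, both claims reduce to counting over these \<open>F choose FS\<close> sets;
  \<open>measure_uniform_random_subset\<close> and \<open>expectation_uniform_random_subset\<close>
  make this reduction. For the distribution, a set meeting \<open>P\<close> in exactly
  \<open>j\<close> points amounts to a free choice of \<open>j\<close> points in \<open>P\<close>
  and of \<open>FS - j\<close> points outside it (\<open>card_subsets_of_card_Int\<close>). The mean
  is not computed from the distribution: double counting of pairs (set, point of \<open>P\<close> in
  it) gives the total number of collisions over all sets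
  (\<open>sum_card_Int_subsets_of_card\<close>), which is linearity of expectation over indicators
  in counting form.\<close>

lemma finite_subsets_of_card: "finite C \<Longrightarrow> finite (subsets_of_card C s)"
  by (simp add: subsets_of_card_def)

lemma card_subsets_of_card: "finite C \<Longrightarrow> card (subsets_of_card C s) = card C choose s"
  by (simp add: subsets_of_card_def n_subsets)

text \<open>Cutting \<open>A\<close> into \<open>A \<inter> P\<close> and \<open>A - P\<close> is a
  bijection onto pairs of independent choices, with union as inverse. The bound
  \<open>j \<le> s\<close> keeps \<open>s - j\<close> from truncating to 0, which would turn the
  last factor into 1 although no such \<open>A\<close> exists.\<close>

lemma card_subsets_of_card_Int:
  assumes C: "finite C" and P: "P \<subseteq> C" and j: "j \<le> s"
  shows "card {A \<in> subsets_of_card C s. card (A \<inter> P) = j} =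
    (card P choose j) * (card C - card P choose (s - j))"
proof -
  have finP: "finite P" using C P by (rule rev_finite_subset)
  have bij: "bij_betw (\<lambda>A. (A \<inter> P, A - P)) {A \<in> subsets_of_card C s. card (A \<inter> P) = j}
      (subsets_of_card P j \<times> subsets_of_card (C - P) (s - j))"
  proof (rule bij_betwI[where g = "\<lambda>(X, Y). X \<union> Y"])
    show "(\<lambda>A. (A \<inter> P, A - P)) \<in> {A \<in> subsets_of_card C s. card (A \<inter> P) = j} \<rightarrow>
        subsets_of_card P j \<times> subsets_of_card (C - P) (s - j)"
    proof
      fix A assume A: "A \<in> {A \<in> subsets_of_card C s. card (A \<inter> P) = j}"
      then have "card (A - P) = s - j"
        using finP by (subst card_Diff_subset_Int) (auto simp: subsets_of_card_def)
      with A show "(A \<inter> P, A - P) \<in> subsets_of_card P j \<times> subsets_of_card (C - P) (s - j)"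
        by (auto simp: subsets_of_card_def)
    qed
    show "(\<lambda>(X, Y). X \<union> Y) \<in> subsets_of_card P j \<times> subsets_of_card (C - P) (s - j) \<rightarrow>
        {A \<in> subsets_of_card C s. card (A \<inter> P) = j}"
    proof (clarsimp simp: subsets_of_card_def)
      fix X Y assume X: "X \<subseteq> P" and Y: "Y \<subseteq> C - P" "card Y = s - card X" and "j = card X"
      then have "finite X" "finite Y" "X \<inter> Y = {}" "(X \<union> Y) \<inter> P = X"
        using C finP by (auto intro: finite_subset)
      with X Y P j \<open>j = card X\<close>
      show "X \<subseteq> C \<and> Y \<subseteq> C \<and> card (X \<union> Y) = s \<and> card ((X \<union> Y) \<inter> P) = card X"
        by (auto simp: card_Un_disjoint)
    qed
  qed (auto simp: subsets_of_card_def)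
  show ?thesis
    using bij_betw_same_card[OF bij] C P finP
    by (simp add: card_cartesian_product card_subsets_of_card card_Diff_subset)
qed

text \<open>Swapping the order of summation counts, for each \<open>x\<close> in \<open>P\<close>,
  the sets containing \<open>x\<close>. Multiplying by \<open>card C\<close> keeps the identity in
  the naturals, free of division.\<close>

lemma sum_card_Int_subsets_of_card:
  assumes C: "finite C" and P: "P \<subseteq> C"
  shows "card C * (\<Sum>A\<in>subsets_of_card C s. card (A \<inter> P)) = s * card P * (card C choose s)"
\<comment> \<open>At \<open>s = 0\<close> the truncated \<open>s - 1\<close> would make the count
  below equal 1 instead of 0.\<close>
proof (cases "s = 0")
  case True
  have "card (A \<inter> P) = 0" if "A \<in> subsets_of_card C 0" for A
    using that C by (auto simp: subsets_of_card_def dest: finite_subset)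
  then have "(\<Sum>A\<in>subsets_of_card C 0. card (A \<inter> P)) = 0"
    by (intro sum.neutral) blast
  with True show ?thesis by simp
next
  case False
  have finP: "finite P" using C P by (rule rev_finite_subset)
  \<comment> \<open>The splitting count for the singleton \<open>{x}\<close> with
    \<open>j = 1\<close>: the point \<open>x\<close> is forced, and \<open>s - 1\<close> others are
    chosen freely.\<close>
  have count: "card {A \<in> subsets_of_card C s. x \<in> A} = card C - 1 choose (s - 1)" if "x \<in> P" for x
  proof -
    have "card (A \<inter> {x}) = 1 \<longleftrightarrow> x \<in> A" for A by (cases "x \<in> A") auto
    then show ?thesis
      using card_subsets_of_card_Int[of C "{x}" 1 s] that C P False by auto
  qed
  have "(\<Sum>A\<in>subsets_of_card C s. card (A \<inter> P)) =
      (\<Sum>A\<in>subsets_of_card C s. \<Sum>x\<in>P. of_bool (x \<in> A))"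
    using finP by (intro sum.cong refl) (simp add: Int_commute Int_def)
  also have "\<dots> = (\<Sum>x\<in>P. card {A \<in> subsets_of_card C s. x \<in> A})"
    using finite_subsets_of_card[OF C, of s] by (subst sum.swap) (simp add: Int_def)
  also have "\<dots> = card P * (card C - 1 choose (s - 1))"
    by (simp add: count)
  \<comment> \<open>Absorption: \<open>s * (n choose s) = n * (n - 1 choose (s - 1))\<close> with
    \<open>n = card C\<close>.\<close>
  finally show ?thesis
    using times_binomial_minus1_eq[of s "card C"] False by (simp add: ac_simps)
qed

lemma binom_of_nat: "binom (int n) (int k) = n choose k"
  by (simp add: binom_def)

text \<open>An event about \<open>S\<close> is a preimage under \<open>S\<close>, so its probability
  is that of its image law, the normalised counting measure.\<close>

lemma measure_uniform_random_subset:
  assumes C: "finite C" and S: "uniform_random_subset M C s S"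
  shows "measure M {\<omega> \<in> space M. Q (S \<omega>)} =
    card {A \<in> subsets_of_card C s. Q A} / (card C choose s)"
proof -
  let ?U = "uniform_count_measure (subsets_of_card C s)"
  have meas: "S \<in> measurable M ?U" and distr: "distr M ?U S = ?U"
    using S by (auto simp: uniform_random_subset_def)
  have "{\<omega> \<in> space M. Q (S \<omega>)} = S -` {A \<in> subsets_of_card C s. Q A} \<inter> space M"
    using measurable_space[OF meas] by (auto simp: space_uniform_count_measure)
  then have "measure M {\<omega> \<in> space M. Q (S \<omega>)} =
      measure (distr M ?U S) {A \<in> subsets_of_card C s. Q A}"
    using measure_distr[OF meas, of "{A \<in> subsets_of_card C s. Q A}"]
    by (simp add: sets_uniform_count_measure)
  also have "\<dots> = card {A \<in> subsets_of_card C s. Q A} / (card C choose s)"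
    unfolding distr
    using C by (subst measure_uniform_count_measure)
      (auto simp: finite_subsets_of_card card_subsets_of_card)
  finally show ?thesis .
qed

lemma expectation_uniform_random_subset:
  fixes f :: "'c set \<Rightarrow> real"
  assumes C: "finite C" and S: "uniform_random_subset M C s S"
  shows "(\<integral>\<omega>. f (S \<omega>) \<partial>M) = (\<Sum>A\<in>subsets_of_card C s. f A) / (card C choose s)"
proof -
  let ?U = "uniform_count_measure (subsets_of_card C s)"
  have meas: "S \<in> measurable M ?U" and distr: "distr M ?U S = ?U"
    using S by (auto simp: uniform_random_subset_def)
  have "f \<in> borel_measurable ?U"
    by (simp add: measurable_def sets_uniform_count_measure space_uniform_count_measure)
  then have "(\<integral>\<omega>. f (S \<omega>) \<partial>M) = (\<integral>A. f A \<partial>distr M ?U S)"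
    using meas by (simp add: integral_distr)
  also have "\<dots> = (\<Sum>A\<in>subsets_of_card C s. f A) / (card C choose s)"
    unfolding distr unfolding uniform_count_measure_def using C
    by (simp add: lebesgue_integral_point_measure_finite finite_subsets_of_card
        card_subsets_of_card sum_divide_distrib)
  finally show ?thesis .
qed

theorem proposition1:
  fixes M :: "'w measure" and C P :: "'c set"
    and F FS FP :: nat and S :: "'w \<Rightarrow> 'c set"
  assumes "prob_space M"
    and "F \<ge> 1" and "FS \<le> F" and "FP \<le> F"
    and "finite C" and "card C = F"
    and "P \<subseteq> C" and "card P = FP"
    and "uniform_random_subset M C FS S"
  shows "(\<forall>k::int. measure M {\<omega> \<in> space M. int (collisions P S \<omega>) = k} =
            inverse (real (binom (int F) (int FS))) * real (binom (int FP) k)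
              * real (binom (int F - int FP) (int FS - k)))
       \<and> prob_space.expectation M (\<lambda>\<omega>. real (collisions P S \<omega>)) =
            real FS * real FP / real F"
proof (intro conjI allI)
  fix k :: int
  have prob: "measure M {\<omega> \<in> space M. int (collisions P S \<omega>) = k} =
      card {A \<in> subsets_of_card C FS. int (card (A \<inter> P)) = k} / (F choose FS)"
    using measure_uniform_random_subset[OF assms(5,9), of "\<lambda>A. int (card (A \<inter> P)) = k"]
    by (simp add: collisions_def assms(6))
  have "card {A \<in> subsets_of_card C FS. int (card (A \<inter> P)) = k} =
      binom (int FP) k * binom (int F - int FP) (int FS - k)"
  \<comment> \<open>In this range both lower indices are naturals, and an upper index that is too
    small already gives 0 in \<open>choose\<close>. Outside it no set qualifies, and one factor
    vanishes: the first if \<open>k < 0\<close>, the second if \<open>k > FS\<close>.\<close>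
  proof (cases "0 \<le> k \<and> k \<le> int FS")
    case True
    then obtain j where j: "k = int j" "j \<le> FS"
      using zero_le_imp_eq_int by force
    have diff: "int F - int FP = int (F - FP)" "int FS - k = int (FS - j)"
      using assms(4) j by auto
    show ?thesis
      using card_subsets_of_card_Int[OF assms(5,7) j(2)] assms(6,8)
      unfolding diff binom_of_nat by (simp add: j(1) binom_of_nat)
  next
    case False
    have "card (A \<inter> P) \<le> FS" if "A \<in> subsets_of_card C FS" for A
      using that assms(5) by (auto simp: subsets_of_card_def intro!: card_mono dest: finite_subset)
    with False have empty: "{A \<in> subsets_of_card C FS. int (card (A \<inter> P)) = k} = {}"
      by force
    show ?thesis
      unfolding empty using False by (auto simp: binom_def)
  qed
  with prob show "measure M {\<omega> \<in> space M. int (collisions P S \<omega>) = k} =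
      inverse (real (binom (int F) (int FS))) * real (binom (int FP) k)
        * real (binom (int F - int FP) (int FS - k))"
    by (simp add: binom_of_nat divide_inverse ac_simps)
next
  \<comment> \<open>Together with \<open>F \<ge> 1\<close>, this allows the counting identity to be
    divided by both \<open>F\<close> and \<open>F choose FS\<close>.\<close>
  have "real (F choose FS) \<noteq> 0" using assms(3) by simp
  moreover have "real F * (\<Sum>A\<in>subsets_of_card C FS. real (card (A \<inter> P))) =
      real FS * real FP * real (F choose FS)"
    using arg_cong[OF sum_card_Int_subsets_of_card[OF assms(5,7), of FS], of real] assms(6,8)
    by simp
  ultimately have "(\<Sum>A\<in>subsets_of_card C FS. real (card (A \<inter> P))) / real (F choose FS) =
      real FS * real FP / real F"
    using assms(2) by (simp add: frac_eq_eq mult.commute)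
  then show "prob_space.expectation M (\<lambda>\<omega>. real (collisions P S \<omega>)) =
      real FS * real FP / real F"
    using expectation_uniform_random_subset[OF assms(5,9), of "\<lambda>A. real (card (A \<inter> P))"]
    by (simp add: collisions_def assms(6))
qed

end
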